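(* Let $d=2$ and let $\mathcal{P}_\lambda$ be a homogeneous Poisson point process of intensity $\lambda$ in the unit disk. Let $n\ge1$ be an integer, $0\le\theta_1<\theta_2<\dots<\theta_n<2\pi$ and $h_i\in(0,\infty)$ for $i=1,\dots,n$. Then $$\lim_{\lambda\to\infty}P\big[\lambda^{2/3}s(\exp_1(\theta_1),\mathcal{P}_\lambda)\ge h_1;\dots;\lambda^{2/3}s(\exp_1(\theta_n),\mathcal{P}_\lambda)\ge h_n\big]=\prod_{k=1}^n\exp\Big\{-\frac{4\sqrt2}{3}h_k^{3/2}\Big\}.$$ Moreover, for all real $v_1<v_2<\dots<v_n$, $$\lim_{\lambda\to\infty}P\big[\lambda^{2/3}s(\exp_1(\lambda^{-1/3}v_1),\mathcal{P}_\lambda)\ge h_1;\dots;\lambda^{2/3}s(\exp_1(\lambda^{-1/3}v_n),\mathcal{P}_\lambda)\ge h_n\big]$$ $$=\exp\left(-\int_{\inf_{1\le i\le n}(v_i-\sqrt{2h_i})}^{\sup_{1\le i\le n}(v_i+\sqrt{2h_i})}\ \sup_{1\le i\le n}\Big[\Big(h_i-\tfrac12(u-v_i)^2\Big)\mathbf{1}\big(|u-v_i|\le\sqrt{2h_i}\big)\Big]\,du\right).$$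
   Context: The unit disk is $\{x\in\mathbb{R}^2:|x|\le1\}$ and $\mathbb{S}^1$ is its boundary circle. For a finite point set $\mathcal{X}$ in the unit disk and $u\in\mathbb{S}^1$, $s(u,\mathcal{X})=1-\sup\{\langle x,u\rangle:x\in\mathcal{X}\}$ is the defect support function of $\mathrm{conv}(\mathcal{X})$ in direction $u$. $\exp_1(\theta)=(\sin\theta,\cos\theta)$ for $\theta\in\mathbb{R}$. *)

theory Defs
  imports "HOL-Probability.Probability"
begin

text \<open>
  The plane is the Euclidean space \<^typ>\<open>real \<times> real\<close> and the closed unit disk is
  \<^term>\<open>cball 0 1 :: (real \<times> real) set\<close>.  A point process in the disk is a random finite
  subset of it.  The count probabilities are written out because the mean
  \<open>l * measure lborel A\<close> may be zero.  Independence is required for every finite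
  family of pairwise disjoint Borel sets.
\<close>

locale disk_poisson_process = prob_space M for M :: "'w measure" +
  fixes l :: real and X :: "'w \<Rightarrow> (real \<times> real) set"
  assumes intensity_nonneg: "0 \<le> l"
    and finite_points: "\<And>\<omega>. \<omega> \<in> space M \<Longrightarrow> finite (X \<omega>)"
    and points_in_disk: "\<And>\<omega>. \<omega> \<in> space M \<Longrightarrow> X \<omega> \<subseteq> cball 0 1"
    and count_measurable:
      "\<And>A. A \<in> sets borel \<Longrightarrow> A \<subseteq> cball 0 1 \<Longrightarrow>
        (\<lambda>\<omega>. card (X \<omega> \<inter> A)) \<in> M \<rightarrow>\<^sub>M count_space UNIV"
    and count_poisson:
      "\<And>A k. A \<in> sets borel \<Longrightarrow> A \<subseteq> cball 0 1 \<Longrightarrow>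
        prob {\<omega> \<in> space M. card (X \<omega> \<inter> A) = k} =
          exp (- (l * measure lborel A)) * (l * measure lborel A) ^ k / fact k"
    and count_indep:
      "\<And>(I :: nat set) A. finite I \<Longrightarrow> disjoint_family_on A I \<Longrightarrow>
        (\<And>i. i \<in> I \<Longrightarrow> A i \<in> sets borel \<and> A i \<subseteq> cball 0 1) \<Longrightarrow>
        indep_vars (\<lambda>_. count_space UNIV) (\<lambda>i \<omega>. card (X \<omega> \<inter> A i)) I"

text \<open>
  The defect support function takes extended real values: the supremum over the empty
  point set is \<open>-\<infinity>\<close>, so that its defect is \<open>\<infinity>\<close>.
\<close>

definition defect_support :: "real \<times> real \<Rightarrow> (real \<times> real) set \<Rightarrow> ereal" where
  "defect_support u X = 1 - (SUP x\<in>X. ereal (x \<bullet> u))"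

definition exp1 :: "real \<Rightarrow> real \<times> real" where
  "exp1 \<theta> = (sin \<theta>, cos \<theta>)"

end

theory Submission
  imports Defs
begin

text \<open>
  The event that all defects are large says that the Poisson process misses a union of caps of
  the disk, so its probability is the exponential of minus \<open>l\<close> times the area of that union.
  With \<open>c = l powr (- 1/3)\<close> the affine map \<open>(u, w) \<mapsto> (c u, 1 - c\<^sup>2 w)\<close> has Jacobian
  \<open>c\<^sup>3 = 1 / l\<close>. In these coordinates the disk tends to the epigraph of \<open>u\<^sup>2 / 2\<close>, and the cap
  in direction \<open>exp1 (c v)\<close> of height \<open>h c\<^sup>2\<close> tends to the part of that epigraph below the line
  \<open>w = h + u v - v\<^sup>2 / 2\<close>; dominated convergence of the indicators gives the limit of the areas.
  For fixed directions the caps are eventually disjoint, and each of them is a rotated copy of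
  the cap with \<open>v = 0\<close>.
\<close>

section \<open>Caps of the disk and void probabilities\<close>

text \<open>The inequality is strict because a supremum of at most \<open>1 - t\<close> still allows
  points on the chord; missing this set is then exactly a defect of at least
  \<open>t\<close>.\<close>

definition cap :: "real \<times> real \<Rightarrow> real \<Rightarrow> (real \<times> real) set" where
  "cap u t = {x \<in> cball 0 1. 1 - t < x \<bullet> u}"

lemma cap_subset: "cap u t \<subseteq> cball 0 1"
  by (auto simp: cap_def)

lemma cap_borel [measurable]: "cap u t \<in> sets borel"
proof -
  have "cap u t = cball 0 1 \<inter> {x. 1 - t < x \<bullet> u}"
    by (auto simp: cap_def)
  moreover have "open {x. 1 - t < x \<bullet> u}"
    by (intro open_Collect_less continuous_intros)
  ultimately show ?thesis
    by auto
qed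

lemma defect_support_ge_iff:
  assumes "X \<subseteq> cball 0 1"
  shows "ereal t \<le> defect_support u X \<longleftrightarrow> X \<inter> cap u t = {}"
proof -
  define S where "S = (SUP x\<in>X. ereal (x \<bullet> u))"
  \<comment> \<open>Infinite \<open>S\<close> is included: for empty \<open>X\<close> it is
    \<open>-\<infinity>\<close> and both sides hold.\<close>
  have "ereal t \<le> 1 - S \<longleftrightarrow> S \<le> ereal (1 - t)"
    by (cases S) (auto simp: one_ereal_def)
  also have "\<dots> \<longleftrightarrow> (\<forall>x\<in>X. x \<bullet> u \<le> 1 - t)"
    by (simp add: S_def SUP_le_iff)
  also have "\<dots> \<longleftrightarrow> X \<inter> cap u t = {}"
    using assms by (fastforce simp: cap_def)
  finally show ?thesis
    by (simp add: defect_support_def S_def)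
qed

lemma scaled_ge_iff:
  assumes "l > 0"
  shows "ereal h \<le> ereal (l powr a) * S \<longleftrightarrow> ereal (h * l powr - a) \<le> S"
  using assms by (cases S) (auto simp: powr_minus field_simps)

text \<open>The caps may overlap, but the joint event only says that no point lies in their union,
  so the Poisson law of that single count at \<open>k = 0\<close> gives the probability.\<close>

lemma (in disk_poisson_process) prob_void_caps:
  assumes "finite I"
  shows "prob {\<omega> \<in> space M. \<forall>i\<in>I. ereal (t i) \<le> defect_support (u i) (X \<omega>)} =
    exp (- (l * measure lborel (\<Union>i\<in>I. cap (u i) (t i))))"
proof -
  let ?A = "\<Union>i\<in>I. cap (u i) (t i)"
  \<comment> \<open>\<open>card\<close> is 0 on infinite sets too; finiteness of
    \<open>X \<omega>\<close> makes a zero count mean emptiness.\<close>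
  have "(\<forall>i\<in>I. ereal (t i) \<le> defect_support (u i) (X \<omega>)) \<longleftrightarrow> card (X \<omega> \<inter> ?A) = 0"
    if "\<omega> \<in> space M" for \<omega>
    using points_in_disk[OF that] finite_points[OF that]
    by (auto simp: defect_support_ge_iff)
  then have "{\<omega> \<in> space M. \<forall>i\<in>I. ereal (t i) \<le> defect_support (u i) (X \<omega>)} =
      {\<omega> \<in> space M. card (X \<omega> \<inter> ?A) = 0}"
    by blast
  moreover have "?A \<in> sets borel"
    using assms by auto
  moreover have "?A \<subseteq> cball 0 1"
    using cap_subset by blast
  ultimately show ?thesis
    using count_poisson[of ?A 0] by simp
qed

section \<open>Plane areas under shears and rotations\<close>

lemma sets_borel_vimage:
  fixes f :: "'a::topological_space \<Rightarrow> 'b::topological_space"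
  assumes "A \<in> sets borel" "continuous_on UNIV f"
  shows "{x. f x \<in> A} \<in> sets borel"
  using measurable_sets_borel[OF borel_measurable_continuous_onI[OF assms(2)] assms(1)]
  by (simp add: vimage_def)

lemma emeasure_lborel_pair_fst:
  fixes A :: "(real \<times> real) set"
  assumes "A \<in> sets borel"
  shows "emeasure lborel A = (\<integral>\<^sup>+x. emeasure lborel {y. (x, y) \<in> A} \<partial>lborel)"
proof -
  have "A \<in> sets (lborel \<Otimes>\<^sub>M lborel)"
    using assms by (simp only: lborel_prod sets_lborel)
  from lborel.emeasure_pair_measure_alt[OF this] show ?thesis
    by (simp add: lborel_prod vimage_def)
qed

lemma emeasure_lborel_pair_snd:
  fixes A :: "(real \<times> real) set"
  assumes "A \<in> sets borel"
  shows "emeasure lborel A = (\<integral>\<^sup>+y. emeasure lborel {x. (x, y) \<in> A} \<partial>lborel)"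
proof -
  have "A \<in> sets (lborel \<Otimes>\<^sub>M lborel)"
    using assms by (simp only: lborel_prod sets_lborel)
  from lborel_pair.emeasure_pair_measure_alt2[OF this] show ?thesis
    by (simp add: lborel_prod vimage_def)
qed

lemma emeasure_lborel_shift:
  fixes B :: "real set"
  assumes "B \<in> sets borel"
  shows "emeasure lborel {y. y + a \<in> B} = emeasure lborel B"
proof -
  have "emeasure lborel B = emeasure (distr lborel borel ((+) a)) B"
    by (simp add: lborel_distr_plus)
  then show ?thesis
    using assms by (simp add: emeasure_distr vimage_def add.commute)
qed

text \<open>By Fubini: on each vertical line the shear is a translation, which preserves
  length.\<close>

lemma emeasure_lborel_shear_snd:
  fixes A :: "(real \<times> real) set"
  assumes A: "A \<in> sets borel"
  shows "emeasure lborel {(x, y). (x, y + a * x) \<in> A} = emeasure lborel A"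
proof -
  have 1: "{(x, y). (x, y + a * x) \<in> A} \<in> sets borel"
    using sets_borel_vimage[OF A, of "\<lambda>(x, y). (x, y + a * x)"]
    by (simp add: case_prod_unfold continuous_intros)
  have 2: "{y. (x, y) \<in> A} \<in> sets borel" for x
    by (intro sets_borel_vimage[OF A] continuous_intros)
  show ?thesis
    unfolding emeasure_lborel_pair_fst[OF 1] emeasure_lborel_pair_fst[OF A]
    using emeasure_lborel_shift[OF 2] by simp
qed

lemma emeasure_lborel_shear_fst:
  fixes A :: "(real \<times> real) set"
  assumes A: "A \<in> sets borel"
  shows "emeasure lborel {(x, y). (x + a * y, y) \<in> A} = emeasure lborel A"
proof -
  have 1: "{(x, y). (x + a * y, y) \<in> A} \<in> sets borel"
    using sets_borel_vimage[OF A, of "\<lambda>(x, y). (x + a * y, y)"]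
    by (simp add: case_prod_unfold continuous_intros)
  have 2: "{x. (x, y) \<in> A} \<in> sets borel" for y
    by (intro sets_borel_vimage[OF A] continuous_intros)
  show ?thesis
    unfolding emeasure_lborel_pair_snd[OF 1] emeasure_lborel_pair_snd[OF A]
    using emeasure_lborel_shift[OF 2] by simp
qed

text \<open>Rotation is clockwise, to match \<open>exp1\<close>: it takes
  \<open>exp1 0 = (0, 1)\<close> to \<open>exp1 \<theta>\<close>.\<close>

definition rot :: "real \<Rightarrow> real \<times> real \<Rightarrow> real \<times> real" where
  "rot \<theta> p = (fst p * cos \<theta> + snd p * sin \<theta>, snd p * cos \<theta> - fst p * sin \<theta>)"

lemma continuous_rot: "continuous_on S (rot \<theta>)"
  unfolding rot_def by (intro continuous_intros)

lemma rot_add: "rot (a + b) p = rot a (rot b p)"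
  by (simp add: rot_def sin_add cos_add algebra_simps)

text \<open>A rotation is a product of three shears unless its angle is \<open>\<pi>\<close>.\<close>

lemma emeasure_rot_aux:
  assumes A: "A \<in> sets borel" and t: "cos (\<theta> / 2) \<noteq> 0"
  shows "emeasure lborel {p. rot \<theta> p \<in> A} = emeasure lborel A"
proof -
  \<comment> \<open>The factorization is horizontal shear by \<open>tan (\<theta> / 2)\<close>,
    vertical shear by \<open>- sin \<theta>\<close>, then the first shear again. The half-angle
    identities 1 and 2 identify the entries of the product with those of the rotation.\<close>
  define c where "c = tan (\<theta> / 2)"
  have s: "sin \<theta> = 2 * sin (\<theta> / 2) * cos (\<theta> / 2)" and
    co: "cos \<theta> = 1 - 2 * (sin (\<theta> / 2))\<^sup>2"
    using sin_double[of "\<theta> / 2"] cos_double_sin[of "\<theta> / 2"] by simp_all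
  have 1: "1 - sin \<theta> * c = cos \<theta>"
    using t by (simp add: s co c_def tan_def power2_eq_square)
  have "c * cos (\<theta> / 2) = sin (\<theta> / 2)"
    using t by (simp add: c_def tan_def)
  moreover have "1 + cos \<theta> = 2 * cos (\<theta> / 2) * cos (\<theta> / 2)"
    using cos_double_cos[of "\<theta> / 2"] by (simp add: power2_eq_square)
  ultimately have "c * (1 + cos \<theta>) = sin \<theta>"
    by (simp add: s)
  then have 2: "c + c * cos \<theta> = sin \<theta>"
    by (simp add: distrib_left)
  define f where "f = (\<lambda>(x, y). (x + c * y, y :: real))"
  define g where "g = (\<lambda>(x, y). (x, y + (- sin \<theta>) * x))"
  have f: "continuous_on UNIV f" and g: "continuous_on UNIV g"
    by (auto simp: f_def g_def case_prod_unfold intro!: continuous_intros)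
  have mf: "emeasure lborel {p. f p \<in> B} = emeasure lborel B" if "B \<in> sets borel" for B
    using emeasure_lborel_shear_fst[OF that, of c] by (simp add: f_def case_prod_unfold)
  have mg: "emeasure lborel {p. g p \<in> B} = emeasure lborel B" if "B \<in> sets borel" for B
    using emeasure_lborel_shear_snd[OF that, of "- sin \<theta>"] by (simp add: g_def case_prod_unfold)
  have "rot \<theta> p = f (g (f p))" for p
  proof -
    obtain x y where p: "p = (x, y)"
      by fastforce
    have "f (g (f p)) = (x * (1 - sin \<theta> * c) + y * (c + c * (1 - sin \<theta> * c)),
        y * (1 - sin \<theta> * c) - x * sin \<theta>)"
      by (simp add: f_def g_def p algebra_simps)
    then show ?thesis
      by (simp only: 1 2) (simp add: rot_def p)
  qed
  then have "{p. rot \<theta> p \<in> A} = {p. f p \<in> {p. g p \<in> {p. f p \<in> A}}}"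
    by simp
  then show ?thesis
    using A f g by (simp only: mf mg sets_borel_vimage)
qed

text \<open>In the exceptional case the rotation is done in two halves:
  \<open>cos (\<theta> / 2) = 0\<close> forces \<open>cos (\<theta> / 4) \<noteq> 0\<close>, so the
  three-shear argument applies to each half.\<close>

lemma emeasure_rot:
  assumes A: "A \<in> sets borel"
  shows "emeasure lborel {p. rot \<theta> p \<in> A} = emeasure lborel A"
proof (cases "cos (\<theta> / 2) = 0")
  case True
  then have "cos (\<theta> / 2 / 2) \<noteq> 0"
    using cos_double_cos[of "\<theta> / 2 / 2"] by auto
  note * = emeasure_rot_aux[OF _ this]
  have "{p. rot \<theta> p \<in> A} = {p. rot (\<theta> / 2) p \<in> {p. rot (\<theta> / 2) p \<in> A}}"
    using rot_add[of "\<theta> / 2" "\<theta> / 2"] by simp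
  then show ?thesis
    using A continuous_rot by (simp only: * sets_borel_vimage)
qed (rule emeasure_rot_aux[OF A])

lemma measure_cap_exp1: "measure lborel (cap (exp1 \<theta>) t) = measure lborel (cap (exp1 0) t)"
proof -
  have "rot \<theta> p \<in> cap (exp1 \<theta>) t \<longleftrightarrow> p \<in> cap (exp1 0) t" for p
  proof -
    have "rot \<theta> p \<bullet> rot \<theta> q = p \<bullet> q" for q
      using sin_cos_squared_add[of \<theta>] unfolding rot_def inner_prod_def by (simp; algebra)
    moreover have "exp1 \<theta> = rot \<theta> (exp1 0)"
      by (simp add: rot_def exp1_def)
    ultimately show ?thesis
      by (simp add: cap_def norm_eq_sqrt_inner)
  qed
  then show ?thesis
    using emeasure_rot[OF cap_borel, of \<theta> "exp1 \<theta>" t] by (simp add: measure_def)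
qed

section \<open>Rescaling near the boundary circle\<close>

lemma emeasure_lborel_rescale:
  fixes A :: "(real \<times> real) set"
  assumes A: "A \<in> sets borel" and c: "c > 0"
  shows "emeasure lborel A = ennreal (c ^ 3) * emeasure lborel {(u, w). (c * u, 1 - c\<^sup>2 * w) \<in> A}"
proof -
  \<comment> \<open>One scaling factor per basis vector. The second is negative since
    \<open>w\<close> measures depth downwards from the top point \<open>(0, 1)\<close>; the absolute
    values multiply to \<open>c ^ 3\<close>.\<close>
  define k where "k = (\<lambda>j :: real \<times> real. if j = (1, 0) then c else - c\<^sup>2)"
  define T where "T = (\<lambda>x. (0, 1) + (\<Sum>j\<in>Basis. (k j * (x \<bullet> j)) *\<^sub>R j))"
  have T: "T p = (c * fst p, 1 - c\<^sup>2 * snd p)" for p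
    by (cases p) (simp add: T_def k_def Basis_prod_def sum.union_disjoint)
  have prod: "(\<Prod>j\<in>Basis. \<bar>k j\<bar>) = c ^ 3"
    using c by (simp add: k_def Basis_prod_def power3_eq_cube power2_eq_square)
  have contT: "continuous_on UNIV T"
    by (simp add: T[abs_def] continuous_intros)
  then have [measurable]: "T \<in> borel_measurable borel"
    by (rule borel_measurable_continuous_onI)
  have "lborel = density (distr lborel borel T) (\<lambda>_. ennreal (\<Prod>j\<in>Basis. \<bar>k j\<bar>))"
    unfolding T_def using c by (intro lborel_affine_euclidean) (auto simp: k_def)
  then have "emeasure lborel A =
      emeasure (density (distr lborel borel T) (\<lambda>_. ennreal (\<Prod>j\<in>Basis. \<bar>k j\<bar>))) A"
    by (rule arg_cong)
  also have "\<dots> = ennreal (c ^ 3) * emeasure (distr lborel borel T) A"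
    using A by (simp add: emeasure_density nn_integral_cmult prod)
  also have "emeasure (distr lborel borel T) A = emeasure lborel {p. T p \<in> A}"
    using A by (subst emeasure_distr) (auto simp: vimage_def)
  finally show ?thesis
    by (simp add: T case_prod_unfold)
qed

text \<open>Each vertical slice of a graph is a single point. This discards the boundary curves of
  the limit set, where indicators may fail to converge.\<close>

lemma AE_not_graph:
  assumes "continuous_on UNIV (f :: real \<Rightarrow> real)"
  shows "AE p in lborel. snd p \<noteq> f (fst p)"
proof -
  let ?G = "{p. snd p = f (fst p)}"
  have "closed ?G"
    by (intro closed_Collect_eq continuous_intros continuous_on_compose2[OF assms]) auto
  then have G: "?G \<in> sets borel"
    by auto
  have "emeasure lborel ?G = 0"
    by (simp add: emeasure_lborel_pair_fst[OF G])
  then show ?thesis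
    using G by (intro AE_I[where N = ?G]) auto
qed

lemma tendsto_sin_mult_div:
  fixes v :: real
  shows "((\<lambda>c. sin (c * v) / c) \<longlongrightarrow> v) (at_right 0)"
proof -
  have "((\<lambda>c. sin (c * v)) has_field_derivative v) (at 0)"
    by (auto intro!: derivative_eq_intros)
  then show ?thesis
    by (auto simp: has_field_derivative_iff intro: tendsto_mono at_le)
qed

section \<open>Convergence of the rescaled caps\<close>

text \<open>The upper bound is the line \<open>h i + u * v i - (v i)\<^sup>2 / 2\<close>, written
  relative to the parabola so that the slice over \<open>u\<close> shows the height appearing in the
  limiting integral.\<close>

definition paraboloid_caps :: "'i set \<Rightarrow> ('i \<Rightarrow> real) \<Rightarrow> ('i \<Rightarrow> real) \<Rightarrow> (real \<times> real) set" where
  "paraboloid_caps I v h = {(u, w). u\<^sup>2 / 2 < w \<and> (\<exists>i\<in>I. w < u\<^sup>2 / 2 + (h i - 1/2 * (u - v i)\<^sup>2))}"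

lemma paraboloid_caps_borel:
  assumes "finite I"
  shows "paraboloid_caps I v h \<in> sets borel"
proof -
  have "paraboloid_caps I v h = (\<Union>i\<in>I. {p. (fst p)\<^sup>2 / 2 < snd p} \<inter>
      {p. snd p < (fst p)\<^sup>2 / 2 + (h i - 1/2 * (fst p - v i)\<^sup>2)})"
    by (auto simp: paraboloid_caps_def)
  also have "open \<dots>"
    by (intro open_UN ballI open_Int open_Collect_less continuous_intros) auto
  finally show ?thesis
    by auto
qed

definition rescaled_caps :: "'i set \<Rightarrow> ('i \<Rightarrow> real) \<Rightarrow> ('i \<Rightarrow> real) \<Rightarrow> real \<Rightarrow> (real \<times> real) set" where
  "rescaled_caps I v h c =
    {(u, w). (c * u, 1 - c\<^sup>2 * w) \<in> (\<Union>i\<in>I. cap (exp1 (c * v i)) (h i * c\<^sup>2))}"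

lemma rescaled_caps_borel:
  assumes "finite I"
  shows "rescaled_caps I v h c \<in> sets borel"
proof -
  have "(\<Union>i\<in>I. cap (exp1 (c * v i)) (h i * c\<^sup>2)) \<in> sets borel"
    using assms by auto
  from sets_borel_vimage[OF this, of "\<lambda>p. (c * fst p, 1 - c\<^sup>2 * snd p)"] show ?thesis
    by (simp add: rescaled_caps_def case_prod_unfold continuous_intros)
qed

text \<open>Both conditions are divided by \<open>c\<^sup>2\<close>. Writing
  \<open>1 - cos (c * v i)\<close> as twice the squared sine of the half angle leaves only quotients
  \<open>sin (c * x) / c\<close>, which converge as \<open>c\<close> tends to 0.\<close>

lemma rescaled_caps_iff:
  assumes c: "c > 0"
  shows "(u, w) \<in> rescaled_caps I v h c \<longleftrightarrow> u\<^sup>2 + c\<^sup>2 * w\<^sup>2 \<le> 2 * w \<and>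
    (\<exists>i\<in>I. 0 < u * (sin (c * v i) / c) - w * cos (c * v i) - 2 * (sin (c * (v i / 2)) / c)\<^sup>2 + h i)"
proof -
  have "(c * u, 1 - c\<^sup>2 * w) \<in> cball 0 1 \<longleftrightarrow> (c * u)\<^sup>2 + (1 - c\<^sup>2 * w)\<^sup>2 \<le> 1"
    by (simp add: norm_Pair)
  also have "\<dots> \<longleftrightarrow> c\<^sup>2 * (u\<^sup>2 + c\<^sup>2 * w\<^sup>2) \<le> c\<^sup>2 * (2 * w)"
    by (simp add: power2_eq_square algebra_simps)
  also have "\<dots> \<longleftrightarrow> u\<^sup>2 + c\<^sup>2 * w\<^sup>2 \<le> 2 * w"
    using c by simp
  finally have 1: "(c * u, 1 - c\<^sup>2 * w) \<in> cball 0 1 \<longleftrightarrow> u\<^sup>2 + c\<^sup>2 * w\<^sup>2 \<le> 2 * w" .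
  have 2: "1 - h i * c\<^sup>2 < (c * u, 1 - c\<^sup>2 * w) \<bullet> exp1 (c * v i) \<longleftrightarrow>
      0 < u * (sin (c * v i) / c) - w * cos (c * v i) - 2 * (sin (c * (v i / 2)) / c)\<^sup>2 + h i"
    (is "_ \<longleftrightarrow> 0 < ?E") for i
  proof -
    have "cos (c * v i) = 1 - 2 * (sin (c * (v i / 2)))\<^sup>2"
      using cos_double_sin[of "c * (v i / 2)"] by simp
    then have "(c * u, 1 - c\<^sup>2 * w) \<bullet> exp1 (c * v i) - (1 - h i * c\<^sup>2) =
        c * u * sin (c * v i) - c\<^sup>2 * w * cos (c * v i) - 2 * (sin (c * (v i / 2)))\<^sup>2 + h i * c\<^sup>2"
      by (simp add: exp1_def algebra_simps)
    also have "\<dots> = c\<^sup>2 * ?E"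
      using c by (simp add: power2_eq_square field_simps)
    finally have "1 - h i * c\<^sup>2 < (c * u, 1 - c\<^sup>2 * w) \<bullet> exp1 (c * v i) \<longleftrightarrow> 0 < c\<^sup>2 * ?E"
      by linarith
    then show ?thesis
      using c by (simp add: zero_less_mult_iff)
  qed
  show ?thesis
    using 1 2 by (auto simp: rescaled_caps_def cap_def)
qed

text \<open>Away from the boundary curves, membership depends on the signs of finitely many
  functions of \<open>c\<close> with nonzero limits, and such signs are eventually constant.\<close>

lemma eventually_rescaled_caps_iff:
  assumes I: "finite I" and w: "w \<noteq> u\<^sup>2 / 2"
    and w': "\<And>i. i \<in> I \<Longrightarrow> w \<noteq> u\<^sup>2 / 2 + (h i - 1/2 * (u - v i)\<^sup>2)"
  shows "\<forall>\<^sub>F c in at_right 0. (u, w) \<in> rescaled_caps I v h c \<longleftrightarrow> (u, w) \<in> paraboloid_caps I v h"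
proof -
  have sign: "\<forall>\<^sub>F c in at_right 0. 0 < f c \<longleftrightarrow> 0 < a"
    if "(f \<longlongrightarrow> a) (at_right 0)" "a \<noteq> 0" for f :: "real \<Rightarrow> real" and a
  proof (cases "a > 0")
    case True
    then show ?thesis
      using order_tendstoD(1)[OF that(1) True] by (auto elim: eventually_mono)
  next
    case False
    then show ?thesis
      using order_tendstoD(2)[OF that(1), of 0] that(2) by (auto elim: eventually_mono)
  qed
  have "((\<lambda>c. u\<^sup>2 + c\<^sup>2 * w\<^sup>2 - 2 * w) \<longlongrightarrow> u\<^sup>2 + 0\<^sup>2 * w\<^sup>2 - 2 * w) (at_right 0)"
    by (intro tendsto_intros)
  from sign[OF this] have 1: "\<forall>\<^sub>F c in at_right 0. 0 < u\<^sup>2 + c\<^sup>2 * w\<^sup>2 - 2 * w \<longleftrightarrow> w < u\<^sup>2 / 2"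
    using w by (simp add: field_simps)
  have 2: "\<forall>\<^sub>F c in at_right 0. \<forall>i\<in>I.
      0 < u * (sin (c * v i) / c) - w * cos (c * v i) - 2 * (sin (c * (v i / 2)) / c)\<^sup>2 + h i \<longleftrightarrow>
      w < u\<^sup>2 / 2 + (h i - 1/2 * (u - v i)\<^sup>2)"
  proof (intro eventually_ball_finite I ballI)
    fix i assume i: "i \<in> I"
    have "((\<lambda>c. u * (sin (c * v i) / c) - w * cos (c * v i) - 2 * (sin (c * (v i / 2)) / c)\<^sup>2 + h i)
        \<longlongrightarrow> u * v i - w * cos (0 * v i) - 2 * (v i / 2)\<^sup>2 + h i) (at_right 0)"
      by (intro tendsto_intros tendsto_sin_mult_div)
    from sign[OF this] have "\<forall>\<^sub>F c in at_right 0.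
        0 < u * (sin (c * v i) / c) - w * cos (c * v i) - 2 * (sin (c * (v i / 2)) / c)\<^sup>2 + h i \<longleftrightarrow>
        0 < u * v i - w * cos (0 * v i) - 2 * (v i / 2)\<^sup>2 + h i"
      if "u * v i - w * cos (0 * v i) - 2 * (v i / 2)\<^sup>2 + h i \<noteq> 0"
      using that .
    moreover have "u * v i - w * cos (0 * v i) - 2 * (v i / 2)\<^sup>2 + h i =
        u\<^sup>2 / 2 + (h i - 1/2 * (u - v i)\<^sup>2) - w"
      by (simp add: power2_eq_square field_simps)
    ultimately show "\<forall>\<^sub>F c in at_right 0.
        0 < u * (sin (c * v i) / c) - w * cos (c * v i) - 2 * (sin (c * (v i / 2)) / c)\<^sup>2 + h i \<longleftrightarrow>
        w < u\<^sup>2 / 2 + (h i - 1/2 * (u - v i)\<^sup>2)"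
      using w'[OF i, symmetric] by (simp only: right_minus_eq diff_gt_0_iff_gt not_False_eq_True simp_thms)
  qed
  have 3: "\<forall>\<^sub>F c in at_right 0. 0 < (c::real)"
    by (simp add: eventually_at_right_less)
  show ?thesis
    using 1 2 3
  proof eventually_elim
    case (elim c)
    \<comment> \<open>The disk condition is the negation of the strict inequality in 1; as
      \<open>w\<close> is off the parabola, the negation of \<open>w < u\<^sup>2 / 2\<close> is
      strict again.\<close>
    then have "u\<^sup>2 + c\<^sup>2 * w\<^sup>2 \<le> 2 * w \<longleftrightarrow> u\<^sup>2 / 2 < w"
      using w by linarith
    with elim show ?case
      by (simp add: rescaled_caps_iff paraboloid_caps_def)
  qed
qed

text \<open>The disk gives \<open>u\<^sup>2 \<le> 2 * w\<close> and the cap gives a bound on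
  \<open>w\<close> linear in \<open>\<bar>u\<bar>\<close>. A quadratic below a linear function
  confines \<open>u\<close>, hence \<open>w\<close>, uniformly in small \<open>c\<close>; the box
  supplies the dominating function.\<close>

lemma rescaled_caps_bounded:
  assumes I: "finite I" and h: "\<And>i. i \<in> I \<Longrightarrow> h i > 0"
  obtains a b where "\<forall>\<^sub>F c in at_right 0. rescaled_caps I v h c \<subseteq> cbox a b"
proof -
  define H V where "H = (\<Sum>i\<in>I. h i)" and "V = (\<Sum>i\<in>I. \<bar>v i\<bar>)"
  \<comment> \<open>The bounds combine to
    \<open>u\<^sup>2 \<le> 4 * H + 4 * \<bar>u\<bar> * V\<close>. The summand 1 ensures that
    \<open>\<bar>u\<bar> > R\<close> implies \<open>\<bar>u\<bar> \<ge> 1\<close>, so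
    \<open>H\<close> may be replaced by \<open>H * \<bar>u\<bar>\<close>.\<close>
  define R where "R = 4 * H + 4 * V + 1"
  have H: "h i \<le> H" if "i \<in> I" for i
    unfolding H_def using I h that by (intro member_le_sum) (auto simp: less_imp_le)
  have V: "\<bar>v i\<bar> \<le> V" if "i \<in> I" for i
    unfolding V_def using I that by (intro member_le_sum[where f = "\<lambda>i. \<bar>v i\<bar>"]) auto
  \<comment> \<open>This keeps the coefficient of \<open>w\<close> in the cap condition away from
    0.\<close>
  have "\<forall>\<^sub>F c in at_right 0. \<forall>i\<in>I. 1 / 2 < cos (c * v i)"
  proof (intro eventually_ball_finite I ballI)
    fix i
    have "((\<lambda>c. cos (c * v i)) \<longlongrightarrow> cos (0 * v i)) (at_right 0)"
      by (intro tendsto_intros)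
    then show "\<forall>\<^sub>F c in at_right 0. 1 / 2 < cos (c * v i)"
      by (rule order_tendstoD) simp
  qed
  moreover have "\<forall>\<^sub>F c in at_right 0. 0 < (c::real)"
    by (simp add: eventually_at_right_less)
  ultimately have "\<forall>\<^sub>F c in at_right 0. rescaled_caps I v h c \<subseteq> cbox (- R, 0) (R, 2 * (H + R * V))"
  proof eventually_elim
    case (elim c)
    show ?case
    proof
      fix p assume p: "p \<in> rescaled_caps I v h c"
      obtain u w where uw: "p = (u, w)"
        by fastforce
      obtain i where i: "i \<in> I" and disk: "u\<^sup>2 + c\<^sup>2 * w\<^sup>2 \<le> 2 * w"
        and pos: "0 < u * (sin (c * v i) / c) - w * cos (c * v i) - 2 * (sin (c * (v i / 2)) / c)\<^sup>2 + h i"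
        using p elim by (auto simp: uw rescaled_caps_iff)
      have "0 \<le> H" "0 \<le> V"
        using H[OF i] V[OF i] h[OF i] by auto
      have u2: "u\<^sup>2 \<le> 2 * w"
        using disk zero_le_power2[of "c * w"] unfolding power_mult_distrib by linarith
      then have w0: "0 \<le> w"
        using zero_le_power2[of u] by linarith
      have "\<bar>sin (c * v i) / c\<bar> \<le> \<bar>v i\<bar>"
        using elim abs_sin_x_le_abs_x[of "c * v i"] by (simp add: abs_mult field_simps)
      then have "u * (sin (c * v i) / c) \<le> \<bar>u\<bar> * V"
        using V[OF i] by (metis abs_ge_self abs_ge_zero abs_mult mult_left_mono order_trans)
      moreover have "w / 2 \<le> w * cos (c * v i)"
        using mult_left_mono[OF less_imp_le w0, of "1 / 2" "cos (c * v i)"] elim i by simp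
      moreover have "0 \<le> 2 * (sin (c * (v i / 2)) / c)\<^sup>2"
        by simp
      \<comment> \<open>The nonlinear terms are abstracted to variables, leaving a linear
        inequality.\<close>
      moreover have "w \<le> 2 * (H + e)"
        if "0 < a - b - d + x" "a \<le> e" "w / 2 \<le> b" "0 \<le> d" "x \<le> H" for a b d x e :: real
        using that by simp
      ultimately have w: "w \<le> 2 * (H + \<bar>u\<bar> * V)"
        using pos H[OF i] by blast
      have u: "\<bar>u\<bar> \<le> R"
      proof (rule ccontr)
        assume "\<not> \<bar>u\<bar> \<le> R"
        then have "R < \<bar>u\<bar>" "1 \<le> \<bar>u\<bar>"
          using \<open>0 \<le> H\<close> \<open>0 \<le> V\<close> by (auto simp: R_def)
        have "R * \<bar>u\<bar> < \<bar>u\<bar> * \<bar>u\<bar>"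
          using \<open>R < \<bar>u\<bar>\<close> \<open>1 \<le> \<bar>u\<bar>\<close> by (intro mult_strict_right_mono) auto
        also have "\<dots> \<le> 4 * H + 4 * (\<bar>u\<bar> * V)"
          using u2 w by (simp add: power2_eq_square)
        also have "\<dots> \<le> 4 * (H * \<bar>u\<bar>) + 4 * (\<bar>u\<bar> * V)"
          using \<open>1 \<le> \<bar>u\<bar>\<close> \<open>0 \<le> H\<close> by (simp add: mult_le_cancel_left1)
        also have "\<dots> \<le> R * \<bar>u\<bar>"
          by (simp add: R_def algebra_simps)
        finally show False
          by simp
      qed
      have "\<bar>u\<bar> * V \<le> R * V"
        using u \<open>0 \<le> V\<close> by (rule mult_right_mono)
      then show "p \<in> cbox (- R, 0) (R, 2 * (H + R * V))"
        using u w w0 by (auto simp: uw cbox_Pair_eq)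
    qed
  qed
  then show thesis
    by (rule that)
qed

lemma measure_rescaled_caps_tendsto:
  assumes I: "finite I" and h: "\<And>i. i \<in> I \<Longrightarrow> h i > 0"
    and c: "filterlim c (at_right 0) at_top"
  shows "((\<lambda>l::real. measure lborel (rescaled_caps I v h (c l))) \<longlongrightarrow>
    measure lborel (paraboloid_caps I v h)) at_top"
proof -
  obtain a b where bounded: "\<forall>\<^sub>F c in at_right 0. rescaled_caps I v h c \<subseteq> cbox a b"
    using rescaled_caps_bounded[OF I h] .
  note [measurable] = rescaled_caps_borel[OF I] paraboloid_caps_borel[OF I]
  have "((\<lambda>l. integral\<^sup>L lborel (indicator (rescaled_caps I v h (c l)) :: _ \<Rightarrow> real)) \<longlongrightarrow>
      integral\<^sup>L lborel (indicator (paraboloid_caps I v h))) at_top"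
  proof (rule integral_dominated_convergence_at_top)
    show "integrable lborel (indicator (cbox a b) :: _ \<Rightarrow> real)"
      using emeasure_lborel_cbox_finite[of a b] by (simp add: integrable_indicator_iff less_top)
    have "AE p in lborel. snd p \<noteq> (fst p :: real)\<^sup>2 / 2"
      by (intro AE_not_graph[where f = "\<lambda>u. u\<^sup>2 / 2"] continuous_intros) auto
    moreover have "AE p in lborel. \<forall>i\<in>I. snd p \<noteq> (fst p)\<^sup>2 / 2 + (h i - 1/2 * (fst p - v i)\<^sup>2)"
      by (intro AE_finite_allI I AE_not_graph[where f = "\<lambda>u. u\<^sup>2 / 2 + (h i - 1/2 * (u - v i)\<^sup>2)" for i]
          continuous_intros) auto
    ultimately show "AE p in lborel. ((\<lambda>l. indicator (rescaled_caps I v h (c l)) p :: real) \<longlongrightarrow>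
        indicator (paraboloid_caps I v h) p) at_top"
    proof eventually_elim
      case (elim p)
      then have "\<forall>\<^sub>F c in at_right 0. p \<in> rescaled_caps I v h c \<longleftrightarrow> p \<in> paraboloid_caps I v h"
        using eventually_rescaled_caps_iff[OF I, of "snd p" "fst p" h v] by simp
      with c have "\<forall>\<^sub>F l in at_top. p \<in> rescaled_caps I v h (c l) \<longleftrightarrow> p \<in> paraboloid_caps I v h"
        by (auto simp: filterlim_iff)
      then show ?case
        by (intro tendsto_eventually) (auto simp: indicator_def elim: eventually_mono)
    qed
    have "\<forall>\<^sub>F l in at_top. rescaled_caps I v h (c l) \<subseteq> cbox a b"
      using c bounded by (auto simp: filterlim_iff)
    then show "\<forall>\<^sub>F l in at_top. AE p in lborel.
        norm (indicator (rescaled_caps I v h (c l)) p :: real) \<le> indicator (cbox a b) p"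
      by eventually_elim (auto simp: indicator_def)
  qed measurable
  then show ?thesis
    by simp
qed

lemma measure_caps_tendsto:
  assumes I: "finite I" and h: "\<And>i. i \<in> I \<Longrightarrow> h i > 0"
  shows "((\<lambda>l. l * measure lborel (\<Union>i\<in>I. cap (exp1 (l powr - (1/3) * v i)) (h i * l powr - (2/3))))
    \<longlongrightarrow> measure lborel (paraboloid_caps I v h)) at_top"
proof -
  have "filterlim (\<lambda>l::real. l powr - (1/3)) (at_right 0) at_top"
    unfolding filterlim_at
    by (auto intro!: tendsto_neg_powr filterlim_ident eventually_mono[OF eventually_gt_at_top[of 0]])
  from measure_rescaled_caps_tendsto[OF I h this]
  have "((\<lambda>l. measure lborel (rescaled_caps I v h (l powr - (1/3)))) \<longlongrightarrow>
    measure lborel (paraboloid_caps I v h)) at_top" .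
  moreover have "\<forall>\<^sub>F l in at_top. measure lborel (rescaled_caps I v h (l powr - (1/3))) =
      l * measure lborel (\<Union>i\<in>I. cap (exp1 (l powr - (1/3) * v i)) (h i * l powr - (2/3)))"
    using eventually_gt_at_top[of 0]
  proof eventually_elim
    case (elim l)
    define c where "c = l powr - (1/3)"
    let ?A = "\<Union>i\<in>I. cap (exp1 (c * v i)) (h i * c\<^sup>2)"
    \<comment> \<open>These identities match the cap heights to the rescaling and cancel the
      Jacobian against the intensity.\<close>
    have c: "c > 0" "c\<^sup>2 = l powr - (2/3)" "l * c ^ 3 = 1"
      using elim by (simp_all add: c_def powr_power powr_neg_one)
    have "?A \<in> sets borel"
      using I by auto
    from emeasure_lborel_rescale[OF this c(1)]
    have "measure lborel ?A = c ^ 3 * measure lborel (rescaled_caps I v h c)"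
      using c(1) by (simp add: measure_def rescaled_caps_def enn2real_mult)
    then have "l * measure lborel ?A = l * c ^ 3 * measure lborel (rescaled_caps I v h c)"
      by simp
    then show ?case
      by (simp add: c(3) flip: c(2) c_def)
  qed
  ultimately show ?thesis
    by (rule Lim_transform_eventually)
qed

section \<open>The limiting area as an integral\<close>

text \<open>Fubini along vertical lines: the slice over \<open>u\<close> is an open interval above
  the parabola whose length is the largest positive part of the heights, and this vanishes outside
  the range of integration.\<close>

lemma measure_paraboloid_caps:
  fixes v h :: "'i \<Rightarrow> real"
  assumes I: "finite I" "I \<noteq> {}" and h: "\<And>i. i \<in> I \<Longrightarrow> h i > 0"
  shows "measure lborel (paraboloid_caps I v h) =
    (LINT u:{(INF i\<in>I. v i - sqrt (2 * h i)) .. (SUP i\<in>I. v i + sqrt (2 * h i))}|lborel.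
      (SUP i\<in>I. (h i - 1/2 * (u - v i)\<^sup>2) * indicator {w. \<bar>w - v i\<bar> \<le> sqrt (2 * h i)} u))"
    (is "_ = (LINT u:?J|lborel. ?g u)")
proof -
  define g where "g = ?g"
  define b where "b = (\<lambda>i u. (h i - 1/2 * (u - v i)\<^sup>2) * indicator {w. \<bar>w - v i\<bar> \<le> sqrt (2 * h i)} u)"
  have g: "g u = (SUP i\<in>I. b i u)" for u
    by (simp add: g_def b_def)
  have bdd: "bdd_above (f ` I)" "bdd_below (f ` I)" for f :: "'i \<Rightarrow> real"
    using I by auto
  \<comment> \<open>The indicator is 1 exactly where the height is nonnegative, so each term is a
    positive part.\<close>
  have in_range: "\<bar>u - v i\<bar> \<le> sqrt (2 * h i) \<longleftrightarrow> 0 \<le> h i - 1/2 * (u - v i)\<^sup>2" if "i \<in> I" for i u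
    using h[OF that] real_sqrt_le_iff[of "(u - v i)\<^sup>2" "2 * h i"] by (simp add: mult.commute)
  have b: "b i u = max 0 (h i - 1/2 * (u - v i)\<^sup>2)" if "i \<in> I" for i u
    using in_range[OF that] by (auto simp: b_def indicator_def)
  have g_nonneg: "0 \<le> g u" for u
  proof -
    obtain i where "i \<in> I"
      using I by auto
    then show ?thesis
      using b[of i u] by (auto simp: g intro!: cSUP_upper2 bdd)
  qed
  have g_outside: "g u = 0" if "u \<notin> ?J" for u
  proof -
    have "b i u = 0" if i: "i \<in> I" for i
    proof (rule ccontr)
      assume "b i u \<noteq> 0"
      then have *: "v i - sqrt (2 * h i) \<le> u" "u \<le> v i + sqrt (2 * h i)"
        by (auto simp: b_def indicator_def abs_le_iff split: if_splits)
      have "u \<in> ?J"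
        using i * by (auto intro!: cINF_lower2 cSUP_upper2 bdd)
      with \<open>u \<notin> ?J\<close> show False ..
    qed
    then show ?thesis
      using I by (simp add: g cong: SUP_cong_simp)
  qed
  let ?S = "paraboloid_caps I v h"
  have S: "?S \<in> sets borel"
    by (rule paraboloid_caps_borel[OF I(1)])
  have slice: "{w. (u, w) \<in> ?S} = {u\<^sup>2 / 2 <..< u\<^sup>2 / 2 + g u}" for u
  proof -
    have "w < u\<^sup>2 / 2 + g u \<longleftrightarrow> (\<exists>i\<in>I. w < u\<^sup>2 / 2 + (h i - 1/2 * (u - v i)\<^sup>2))"
      if "u\<^sup>2 / 2 < w" for w
    proof -
      have "w < u\<^sup>2 / 2 + g u \<longleftrightarrow> w - u\<^sup>2 / 2 < g u"
        by linarith
      also have "\<dots> \<longleftrightarrow> (\<exists>i\<in>I. w - u\<^sup>2 / 2 < b i u)"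
        unfolding g by (rule less_cSUP_iff[OF I(2) bdd(1)])
      \<comment> \<open>Truncation at 0 changes nothing here, because
        \<open>w - u\<^sup>2 / 2\<close> is positive.\<close>
      also have "\<dots> \<longleftrightarrow> (\<exists>i\<in>I. w < u\<^sup>2 / 2 + (h i - 1/2 * (u - v i)\<^sup>2))"
        using that by (intro bex_cong refl) (auto simp: b max_def)
      finally show ?thesis .
    qed
    then show ?thesis
      by (auto simp: paraboloid_caps_def)
  qed
  have emeasure_slice: "emeasure lborel {w. (u, w) \<in> ?S} = ennreal (g u)" for u
    using g_nonneg[of u] by (simp add: slice)
  \<comment> \<open>Measurability of \<open>g\<close> is inherited from the slice lengths.\<close>
  have "(\<lambda>u. emeasure lborel (Pair u -` ?S)) \<in> borel_measurable lborel"
    using S by (intro lborel.measurable_emeasure_Pair) (simp only: lborel_prod sets_lborel)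
  then have "(\<lambda>u. enn2real (emeasure lborel (Pair u -` ?S))) \<in> borel_measurable lborel"
    by measurable
  then have [measurable]: "g \<in> borel_measurable lborel"
    using g_nonneg by (simp add: vimage_def emeasure_slice)
  have "measure lborel ?S = enn2real (\<integral>\<^sup>+u. ennreal (g u) \<partial>lborel)"
    by (simp add: measure_def emeasure_lborel_pair_fst[OF S] emeasure_slice)
  also have "\<dots> = integral\<^sup>L lborel g"
    using g_nonneg by (intro integral_eq_nn_integral[symmetric]) auto
  also have "\<dots> = (LINT u:?J|lborel. g u)"
    unfolding set_lebesgue_integral_def
    using g_outside by (intro Bochner_Integration.integral_cong refl) (auto simp: indicator_def)
  finally show ?thesis
    by (simp only: g_def)
qed

text \<open>The integral of \<open>h k - u\<^sup>2 / 2\<close> between its zeros \<open>- s\<close>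
  and \<open>s\<close>; with \<open>s\<^sup>2 = 2 * h k\<close> it equals
  \<open>4 / 3 * h k * s\<close>.\<close>

lemma measure_paraboloid_cap:
  assumes h: "h k > 0"
  shows "measure lborel (paraboloid_caps {k} (\<lambda>_. 0) h) = 4 * sqrt 2 / 3 * h k powr (3/2)"
proof -
  define s where "s = sqrt (2 * h k)"
  have s: "s > 0" "s\<^sup>2 = 2 * h k"
    using h by (auto simp: s_def)
  have "measure lborel (paraboloid_caps {k} (\<lambda>_. 0) h) =
      (LINT u:{- s..s}|lborel. (h k - 1/2 * u\<^sup>2) * indicator {w. \<bar>w\<bar> \<le> s} u)"
    using measure_paraboloid_caps[of "{k}" h "\<lambda>_. 0"] h by (simp add: s_def)
  also have "\<dots> = (LINT u:{- s..s}|lborel. h k - 1/2 * u\<^sup>2)"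
    unfolding set_lebesgue_integral_def
    by (intro Bochner_Integration.integral_cong refl) (auto simp: indicator_def)
  also have "\<dots> = (h k * s - s ^ 3 / 6) - (h k * (- s) - (- s) ^ 3 / 6)"
    unfolding set_lebesgue_integral_def real_scaleR_def
    using s(1) by (subst mult.commute, intro integral_FTC_Icc_real)
      (auto intro!: derivative_eq_intros continuous_intros simp: power2_eq_square)
  also have "\<dots> = 2 * h k * s - s\<^sup>2 * s / 3"
    by (simp add: power3_eq_cube power2_eq_square)
  also have "\<dots> = 4 / 3 * h k * s"
    by (simp add: s(2) field_simps)
  also have "\<dots> = 4 * sqrt 2 / 3 * (h k * sqrt (h k))"
    by (simp add: s_def real_sqrt_mult)
  also have "h k * sqrt (h k) = h k powr 1 * h k powr (1/2)"
    using h by (simp add: powr_half_sqrt)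
  also have "\<dots> = h k powr (3/2)"
    unfolding powr_add[symmetric] by simp
  finally show ?thesis .
qed

section \<open>Caps in fixed distinct directions\<close>

text \<open>Expanding the square,
  \<open>(dist x u)\<^sup>2 \<le> 2 - 2 * (x \<bullet> u) < 2 * t\<close>. Thus a cap shrinks to its
  direction.\<close>

lemma dist_cap:
  assumes "x \<in> cap u t" "norm u = 1"
  shows "dist x u < sqrt (2 * t)"
proof -
  have "norm x ^ 2 \<le> 1"
    using assms by (auto simp: cap_def power_le_one)
  moreover have "(dist x u)\<^sup>2 = norm x ^ 2 + norm u ^ 2 - 2 * (x \<bullet> u)"
    by (simp add: dist_norm power2_norm_eq_inner inner_diff inner_commute)
  ultimately have "(dist x u)\<^sup>2 < 2 * t"
    using assms by (auto simp: cap_def)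
  then show ?thesis
    by (rule real_less_rsqrt)
qed

lemma exp1_inj:
  assumes "exp1 a = exp1 b" "0 \<le> a" "a < 2 * pi" "0 \<le> b" "b < 2 * pi"
  shows "a = b"
proof -
  obtain k :: int where k: "a = b + 2 * pi * k"
    using assms(1) sin_cos_eq_iff[of a b] by (auto simp: exp1_def)
  have "2 * pi * real_of_int k < 2 * pi * 1" "2 * pi * (- 1) < 2 * pi * real_of_int k"
    using k assms(2-5) by linarith+
  then have "real_of_int k < 1" "- 1 < real_of_int k"
    by (simp_all only: mult_less_cancel_left_pos[of "2 * pi"] pi_gt_zero zero_less_numeral mult_pos_pos)
  then have "k = 0"
    by linarith
  with k show ?thesis
    by simp
qed

lemma tendsto_height: "((\<lambda>l::real. h * l powr - (2/3)) \<longlongrightarrow> 0) at_top"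
  by (intro tendsto_mult_right_zero tendsto_neg_powr filterlim_ident) auto

text \<open>A rotation moves the cap to direction \<open>exp1 0\<close>, where the scaling limit
  with one index and \<open>v = 0\<close> applies.\<close>

lemma measure_cap_tendsto:
  assumes "h > 0"
  shows "((\<lambda>l. l * measure lborel (cap (exp1 \<theta>) (h * l powr - (2/3)))) \<longlongrightarrow>
    4 * sqrt 2 / 3 * h powr (3/2)) at_top"
  using measure_caps_tendsto[of "{()}" "\<lambda>_. h" "\<lambda>_. 0"] assms
  by (simp add: measure_paraboloid_cap[where h = "\<lambda>_. h"] measure_cap_exp1[of \<theta>])

text \<open>The radii from \<open>dist_cap\<close> tend to 0, so any two of them eventually sum to
  less than the distance between the directions; a common point would violate the triangle
  inequality.\<close>

lemma eventually_disjoint_caps: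
  assumes I: "finite I" and inj: "inj_on (\<lambda>i. exp1 (\<theta> i)) I"
  shows "\<forall>\<^sub>F l in at_top. disjoint_family_on (\<lambda>i. cap (exp1 (\<theta> i)) (h i * l powr - (2/3))) I"
proof -
  have "\<forall>\<^sub>F l in at_top. \<forall>i\<in>I. \<forall>j\<in>I. i \<noteq> j \<longrightarrow>
      sqrt (2 * (h i * l powr - (2/3))) + sqrt (2 * (h j * l powr - (2/3))) < dist (exp1 (\<theta> i)) (exp1 (\<theta> j))"
  proof (intro eventually_ball_finite I ballI)
    fix i j assume ij: "i \<in> I" "j \<in> I"
    have "((\<lambda>l. sqrt (2 * (h i * l powr - (2/3))) + sqrt (2 * (h j * l powr - (2/3)))) \<longlongrightarrow>
        sqrt (2 * 0) + sqrt (2 * 0)) at_top"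
      by (intro tendsto_intros tendsto_height)
    moreover have "0 < dist (exp1 (\<theta> i)) (exp1 (\<theta> j))" if "i \<noteq> j"
      using inj ij that by (auto dest: inj_onD)
    ultimately show "\<forall>\<^sub>F l in at_top. i \<noteq> j \<longrightarrow> sqrt (2 * (h i * l powr - (2/3))) +
        sqrt (2 * (h j * l powr - (2/3))) < dist (exp1 (\<theta> i)) (exp1 (\<theta> j))"
      by (cases "i = j") (simp_all add: order_tendstoD(2))
  qed
  then show ?thesis
  proof eventually_elim
    case (elim l)
    have "norm (exp1 a) = 1" for a
      by (simp add: exp1_def norm_Pair)
    note dist = dist_cap[OF _ this]
    have "i = j" if "i \<in> I" "j \<in> I" "x \<in> cap (exp1 (\<theta> i)) (h i * l powr - (2/3))"
      "x \<in> cap (exp1 (\<theta> j)) (h j * l powr - (2/3))" for i j x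
    proof (rule ccontr)
      assume "i \<noteq> j"
      then have "sqrt (2 * (h i * l powr - (2/3))) + sqrt (2 * (h j * l powr - (2/3))) <
          dist (exp1 (\<theta> i)) (exp1 (\<theta> j))"
        using elim that(1,2) by blast
      then show False
        using dist[OF that(3)] dist[OF that(4)] dist_triangle3[of "exp1 (\<theta> i)" "exp1 (\<theta> j)" x]
        by linarith
    qed
    then show ?case
      unfolding disjoint_family_on_def by blast
  qed
qed

lemma measure_separated_caps_tendsto:
  assumes I: "finite I" and inj: "inj_on (\<lambda>i. exp1 (\<theta> i)) I" and h: "\<And>i. i \<in> I \<Longrightarrow> h i > 0"
  shows "((\<lambda>l. l * measure lborel (\<Union>i\<in>I. cap (exp1 (\<theta> i)) (h i * l powr - (2/3)))) \<longlongrightarrow>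
    (\<Sum>i\<in>I. 4 * sqrt 2 / 3 * h i powr (3/2))) at_top"
proof -
  have "((\<lambda>l. \<Sum>i\<in>I. l * measure lborel (cap (exp1 (\<theta> i)) (h i * l powr - (2/3)))) \<longlongrightarrow>
      (\<Sum>i\<in>I. 4 * sqrt 2 / 3 * h i powr (3/2))) at_top"
    using h by (intro tendsto_sum measure_cap_tendsto)
  moreover have "\<forall>\<^sub>F l in at_top.
      (\<Sum>i\<in>I. l * measure lborel (cap (exp1 (\<theta> i)) (h i * l powr - (2/3)))) =
      l * measure lborel (\<Union>i\<in>I. cap (exp1 (\<theta> i)) (h i * l powr - (2/3)))"
    using eventually_disjoint_caps[OF I inj, of h]
  proof eventually_elim
    case (elim l)
    have "emeasure lborel (cap u t) \<noteq> \<infinity>" for u t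
    proof -
      have "emeasure lborel (cap u t) \<le> emeasure lborel (cball (0 :: real \<times> real) 1)"
        using cap_subset by (intro emeasure_mono) auto
      also have "\<dots> < \<infinity>"
        by (rule emeasure_lborel_cball_finite)
      finally show ?thesis
        by simp
    qed
    with elim I show ?case
      by (subst measure_finite_Union) (auto simp: sum_distrib_left)
  qed
  ultimately show ?thesis
    by (rule Lim_transform_eventually)
qed

section \<open>From areas to probabilities\<close>

text \<open>The exact void formula is applied on each space \<open>M l\<close> separately, so no
  coupling between intensities enters. Directions may depend on \<open>l\<close>, which serves both
  limits.\<close>

lemma void_probability_tendsto:
  assumes poisson: "\<And>l. l > 0 \<Longrightarrow> disk_poisson_process (M l) l (P l)"
    and I: "finite I"
    and lim: "((\<lambda>l. l * measure lborel (\<Union>i\<in>I. cap (u l i) (h i * l powr - (2/3)))) \<longlongrightarrow> a) at_top"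
  shows "((\<lambda>l. measure (M l) {\<omega> \<in> space (M l). \<forall>i\<in>I.
    ereal (l powr (2/3)) * defect_support (u l i) (P l \<omega>) \<ge> ereal (h i)}) \<longlongrightarrow> exp (- a)) at_top"
proof (rule Lim_transform_eventually)
  show "((\<lambda>l. exp (- (l * measure lborel (\<Union>i\<in>I. cap (u l i) (h i * l powr - (2/3)))))) \<longlongrightarrow> exp (- a)) at_top"
    by (intro tendsto_intros lim)
  show "\<forall>\<^sub>F l in at_top. exp (- (l * measure lborel (\<Union>i\<in>I. cap (u l i) (h i * l powr - (2/3))))) =
      measure (M l) {\<omega> \<in> space (M l). \<forall>i\<in>I.
        ereal (l powr (2/3)) * defect_support (u l i) (P l \<omega>) \<ge> ereal (h i)}"
    using eventually_gt_at_top[of 0]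
  proof eventually_elim
    case (elim l)
    interpret disk_poisson_process "M l" l "P l"
      using poisson[OF elim] .
    show ?case
      by (simp only: scaled_ge_iff[OF elim] prob_void_caps[OF I])
  qed
qed

theorem proposition5p1:
  fixes M :: "real \<Rightarrow> 'w measure"
    and P :: "real \<Rightarrow> 'w \<Rightarrow> (real \<times> real) set"
    and n :: nat
    and \<theta> h :: "nat \<Rightarrow> real"
  assumes poisson: "\<And>l. l > 0 \<Longrightarrow> disk_poisson_process (M l) l (P l)"
    and n: "n \<ge> 1"
    and theta: "0 \<le> \<theta> 1" "strict_mono_on {1..n} \<theta>" "\<theta> n < 2 * pi"
    and h: "\<And>i. i \<in> {1..n} \<Longrightarrow> h i > 0"
  shows
    "((\<lambda>l. measure (M l) {\<omega> \<in> space (M l). \<forall>i\<in>{1..n}.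
          ereal (l powr (2/3)) * defect_support (exp1 (\<theta> i)) (P l \<omega>) \<ge> ereal (h i)})
        \<longlongrightarrow> (\<Prod>k\<in>{1..n}. exp (- (4 * sqrt 2 / 3 * h k powr (3/2))))) at_top
     \<and>
     (\<forall>v :: nat \<Rightarrow> real. strict_mono_on {1..n} v \<longrightarrow>
       ((\<lambda>l. measure (M l) {\<omega> \<in> space (M l). \<forall>i\<in>{1..n}.
          ereal (l powr (2/3)) * defect_support (exp1 (l powr (- (1/3)) * v i)) (P l \<omega>)
            \<ge> ereal (h i)})
        \<longlongrightarrow> exp (- (LINT u:{(INF i\<in>{1..n}. v i - sqrt (2 * h i)) .. (SUP i\<in>{1..n}. v i + sqrt (2 * h i))}|lborel.
              (SUP i\<in>{1..n}. (h i - 1/2 * (u - v i)\<^sup>2)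
                 * indicator {w. \<bar>w - v i\<bar> \<le> sqrt (2 * h i)} u)))) at_top)"
proof (intro conjI allI impI)
  \<comment> \<open>Monotonicity extends the bounds on the first and last angles to all of them; on
    \<open>[0, 2 * pi)\<close> distinct angles give distinct directions.\<close>
  have range: "0 \<le> \<theta> i" "\<theta> i < 2 * pi" if "i \<in> {1..n}" for i
    using strict_mono_on_leD[OF theta(2), of 1 i] strict_mono_on_leD[OF theta(2), of i n] that theta(1,3)
    by simp_all
  have "inj_on (\<lambda>i. exp1 (\<theta> i)) {1..n}"
  proof (rule inj_onI)
    fix i j assume ij: "i \<in> {1..n}" "j \<in> {1..n}" and "exp1 (\<theta> i) = exp1 (\<theta> j)"
    then have "\<theta> i = \<theta> j"
      by (intro exp1_inj range)
    then show "i = j"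
      using inj_onD[OF strict_mono_on_imp_inj_on[OF theta(2)] _ ij] by blast
  qed
  from measure_separated_caps_tendsto[OF _ this h]
  have "((\<lambda>l. l * measure lborel (\<Union>i\<in>{1..n}. cap (exp1 (\<theta> i)) (h i * l powr - (2/3)))) \<longlongrightarrow>
      (\<Sum>i\<in>{1..n}. 4 * sqrt 2 / 3 * h i powr (3/2))) at_top"
    by simp
  from void_probability_tendsto[OF poisson _ this]
  show "((\<lambda>l. measure (M l) {\<omega> \<in> space (M l). \<forall>i\<in>{1..n}.
      ereal (l powr (2/3)) * defect_support (exp1 (\<theta> i)) (P l \<omega>) \<ge> ereal (h i)})
    \<longlongrightarrow> (\<Prod>k\<in>{1..n}. exp (- (4 * sqrt 2 / 3 * h k powr (3/2))))) at_top"
    by (simp add: exp_sum flip: sum_negf)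
next
  fix v :: "nat \<Rightarrow> real"
  \<comment> \<open>Nonemptiness comes from \<open>n \<ge> 1\<close> and gives the real
    \<open>INF\<close> and \<open>SUP\<close> their usual meaning.\<close>
  have I: "finite {1..n}" "{1..n} \<noteq> {}"
    using n by auto
  from void_probability_tendsto[OF poisson I(1) measure_caps_tendsto[OF I(1) h, where v = v]]
  show "((\<lambda>l. measure (M l) {\<omega> \<in> space (M l). \<forall>i\<in>{1..n}.
      ereal (l powr (2/3)) * defect_support (exp1 (l powr (- (1/3)) * v i)) (P l \<omega>) \<ge> ereal (h i)})
    \<longlongrightarrow> exp (- (LINT u:{(INF i\<in>{1..n}. v i - sqrt (2 * h i)) .. (SUP i\<in>{1..n}. v i + sqrt (2 * h i))}|lborel.
          (SUP i\<in>{1..n}. (h i - 1/2 * (u - v i)\<^sup>2)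
             * indicator {w. \<bar>w - v i\<bar> \<le> sqrt (2 * h i)} u)))) at_top"
    by (simp only: measure_paraboloid_caps[OF I h])
qed

end
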